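(* For any $g\in L^\infty([0,1])$ there is an increasing sequence of natural numbers $\{K_n\}_{n=1}^\infty$ such that $$\lim_{n\to\infty}\Big(\sum_{k=0}^{K_n-1}|g_k^{K_n}(t)|^2\Big)^{1/2}=\|g\|\chi_{[0,1]}\quad\text{a.e.}$$
   Context: For $g\in L^2[0,1]$, $K\in\mathbb N$ and $0\le k\le K-1$, $$g_k^K(t)=\sum_{n\in\mathbb Z}\langle g,e^{2\pi i(nK+k)t}\rangle e^{2\pi i(nK+k)t}$$ (convergence in $L^2[0,1]$). $\|g\|$ is the $L^2[0,1]$ norm. *)

theory Defs
  imports "HOL-Analysis.Analysis"
begin

abbreviation unit_leb :: "real measure" where
  "unit_leb \<equiv> lebesgue_on {0..1}"

definition in_Linf :: "(real \<Rightarrow> complex) \<Rightarrow> bool" where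
  "in_Linf g \<longleftrightarrow> g \<in> borel_measurable unit_leb \<and> (\<exists>C. AE t in unit_leb. norm (g t) \<le> C)"

definition in_L2 :: "(real \<Rightarrow> complex) \<Rightarrow> bool" where
  "in_L2 g \<longleftrightarrow> g \<in> borel_measurable unit_leb \<and> integrable unit_leb (\<lambda>t. (norm (g t))\<^sup>2)"

definition L2_inner :: "(real \<Rightarrow> complex) \<Rightarrow> (real \<Rightarrow> complex) \<Rightarrow> complex" where
  "L2_inner f g = (LINT t|unit_leb. f t * cnj (g t))"

definition L2_norm :: "(real \<Rightarrow> complex) \<Rightarrow> real" where
  "L2_norm g = sqrt (LINT t|unit_leb. (norm (g t))\<^sup>2)"

definition trig :: "int \<Rightarrow> real \<Rightarrow> complex" where
  "trig m t = exp (2 * of_real pi * \<i> * of_int m * of_real t)"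

text \<open>
  Convergence in \<open>L\<^sup>2[0,1]\<close> of a series indexed by the integers to \<open>h\<close>, taken along the net of
  finite subsets of the index set, as for the library's \<^const>\<open>has_sum\<close>. Membership of the
  limit (and of the terms) in \<open>L\<^sup>2[0,1]\<close> is required because \<^const>\<open>L2_norm\<close> has the default
  value 0 on functions that are not square-integrable.
\<close>
definition has_L2_sum :: "(int \<Rightarrow> real \<Rightarrow> complex) \<Rightarrow> (real \<Rightarrow> complex) \<Rightarrow> bool" where
  "has_L2_sum u h \<longleftrightarrow> (\<forall>n. in_L2 (u n)) \<and> in_L2 h \<and>
     ((\<lambda>F. L2_norm (\<lambda>t. (\<Sum>n\<in>F. u n t) - h t)) \<longlongrightarrow> 0) (finite_subsets_at_top UNIV)"

text \<open>
  The sum of the series is determined only up to a null set; the choice operator picks a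
  representative, a function on the real line of which only the values on \<open>[0,1]\<close> matter.
  Statements that hold almost everywhere and involve countably many of these functions
  do not depend on the choice.
\<close>
definition fourier_part :: "(real \<Rightarrow> complex) \<Rightarrow> nat \<Rightarrow> nat \<Rightarrow> real \<Rightarrow> complex" where
  "fourier_part g K k = (SOME h. has_L2_sum
     (\<lambda>n t. L2_inner g (trig (n * int K + int k)) * trig (n * int K + int k) t) h)"

end

theory Submission
  imports Defs
begin

text \<open>
  Up to a null set, \<open>g\<close> agrees with a bounded Borel function \<open>f\<close> on the line of period 1. Averaging the
  translates of \<open>f\<close> by \<open>j/K\<close> against the character \<open>j \<mapsto> exp (- 2 \<pi> \<i> k j / K)\<close> kills every frequency
  outside the class of \<open>k\<close> modulo \<open>K\<close> and keeps the others, so \<open>g_k^K (t)\<close> equals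
  \<open>1/K * (\<Sum>j<K. exp (- 2 \<pi> \<i> k j / K) * f (t + j/K))\<close> for almost every \<open>t\<close>.
  For fixed \<open>t\<close> this is a discrete Fourier transform in \<open>k\<close> of the values \<open>f(t + j/K)\<close>, and Parseval's
  identity on the cyclic group of order \<open>K\<close> (\<open>sum_norm_DFT\<close>) turns the square function into a Riemann
  sum: \<open>(\<Sum>k<K. \<bar>g_k^K (t)\<bar>\<^sup>2) = 1/K * (\<Sum>j<K. \<bar>f (t + j/K)\<bar>\<^sup>2)\<close>.

  These equidistant Riemann sums converge in \<open>L\<^sup>1\<close> to the mean of \<open>|f|\<^sup>2\<close>, which is the square of the norm
  of \<open>g\<close>: they are contractions of \<open>L\<^sup>1\<close>, and on a trigonometric polynomial they equal the mean as soon
  as \<open>K\<close> exceeds all its frequencies (\<open>residue_part_0_tendsto_integral\<close>). A sequence converging in \<open>L\<^sup>1\<close>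
  has a subsequence converging almost everywhere, and this subsequence supplies the \<open>K\<^sub>n\<close>.

  Both the identification of \<open>g_k^K\<close> and the \<open>L\<^sup>1\<close> convergence rest on the density of trigonometric
  polynomials in \<open>L\<^sup>2\<close> (\<open>trig_polynomial_L2_dense\<close>), obtained from the Stone--Weierstrass theorem on the
  unit circle.
\<close>

section \<open>Bounded functions of period one\<close>

text \<open>
  Boundedness makes these functions and their products integrable over the unit interval, and Borel measurability, as opposed to Lebesgue
  measurability, makes translates and compositions measurable without further argument.
\<close>

definition bounded_periodic :: "(real \<Rightarrow> complex) \<Rightarrow> bool" where
  "bounded_periodic f \<longleftrightarrow> f \<in> borel_measurable borel \<and> (\<exists>C. \<forall>t. norm (f t) \<le> C) \<and> (\<forall>t. f (t + 1) = f t)"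

lemma finite_measure_unit_leb: "finite_measure unit_leb"
  by (rule finite_measure_lebesgue_on) auto

lemma measure_unit_leb: "measure unit_leb (space unit_leb) = 1"
  by (subst measure_restrict_space) auto

lemma borel_imp_measurable_unit_leb:
  "f \<in> borel_measurable borel \<Longrightarrow> f \<in> borel_measurable unit_leb"
  by (intro measurable_restrict_space1 measurable_completion) simp

lemma AE_unit_lebI: "AE t in lborel. P t \<Longrightarrow> AE t in unit_leb. P t"
  by (subst AE_restrict_space_iff) (auto intro: AE_completion elim: eventually_mono)

lemma integrable_unit_leb_bounded:
  fixes f :: "real \<Rightarrow> 'a::{banach, second_countable_topology}"
  assumes "f \<in> borel_measurable unit_leb" "\<And>t. norm (f t) \<le> C"
  shows "integrable unit_leb f"
  by (rule finite_measure.integrable_const_bound[OF finite_measure_unit_leb, of _ C]) (use assms in auto)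

lemma bounded_periodicI:
  assumes "f \<in> borel_measurable borel" "\<And>t. norm (f t) \<le> C" "\<And>t. f (t + 1) = f t"
  shows "bounded_periodic f"
  using assms unfolding bounded_periodic_def by blast

lemma bounded_periodicE:
  assumes "bounded_periodic f"
  obtains C where "f \<in> borel_measurable borel" "\<And>t. norm (f t) \<le> C" "\<And>t. f (t + 1) = f t"
  using assms unfolding bounded_periodic_def by blast

lemma bounded_periodic_integrable:
  assumes "bounded_periodic f"
  shows "integrable unit_leb f"
  using assms by (elim bounded_periodicE) (rule integrable_unit_leb_bounded[OF borel_imp_measurable_unit_leb])

lemma bounded_periodic_const: "bounded_periodic (\<lambda>_. c)"
  by (rule bounded_periodicI[where C = "norm c"]) auto

lemma bounded_periodic_add:
  assumes "bounded_periodic f" "bounded_periodic g"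
  shows "bounded_periodic (\<lambda>t. f t + g t)"
proof -
  obtain C where f: "f \<in> borel_measurable borel" "\<And>t. norm (f t) \<le> C" "\<And>t. f (t + 1) = f t"
    using assms(1) by (rule bounded_periodicE) blast
  obtain D where g: "g \<in> borel_measurable borel" "\<And>t. norm (g t) \<le> D" "\<And>t. g (t + 1) = g t"
    using assms(2) by (rule bounded_periodicE) blast
  have m: "(\<lambda>t. f t + g t) \<in> borel_measurable borel" using f(1) g(1) by measurable
  show ?thesis
    by (rule bounded_periodicI[where C = "C + D"])
       (auto intro!: m norm_triangle_mono f(2) g(2) simp: f(3) g(3))
qed

lemma bounded_periodic_mult:
  assumes "bounded_periodic f" "bounded_periodic g"
  shows "bounded_periodic (\<lambda>t. f t * g t)"
proof -
  obtain C where f: "f \<in> borel_measurable borel" "\<And>t. norm (f t) \<le> C" "\<And>t. f (t + 1) = f t"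
    using assms(1) by (rule bounded_periodicE) blast
  obtain D where g: "g \<in> borel_measurable borel" "\<And>t. norm (g t) \<le> D" "\<And>t. g (t + 1) = g t"
    using assms(2) by (rule bounded_periodicE) blast
  have m: "(\<lambda>t. f t * g t) \<in> borel_measurable borel" using f(1) g(1) by measurable
  have C: "0 \<le> C" using order_trans[OF norm_ge_zero f(2)] .
  show ?thesis
    by (rule bounded_periodicI[where C = "C * D"])
       (auto intro!: m mult_mono C f(2) g(2) simp: f(3) g(3) norm_mult)
qed

lemma bounded_periodic_diff:
  assumes "bounded_periodic f" "bounded_periodic g"
  shows "bounded_periodic (\<lambda>t. f t - g t)"
  using bounded_periodic_add[OF assms(1) bounded_periodic_mult[OF bounded_periodic_const[of "-1"] assms(2)]]
  by simp

lemma bounded_periodic_sum: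
  assumes "\<And>i. i \<in> A \<Longrightarrow> bounded_periodic (f i)"
  shows "bounded_periodic (\<lambda>t. \<Sum>i\<in>A. f i t)"
  using assms
  by (induction A rule: infinite_finite_induct)
     (auto intro: bounded_periodic_const bounded_periodic_add)

lemma bounded_periodic_cnj:
  assumes "bounded_periodic f"
  shows "bounded_periodic (\<lambda>t. cnj (f t))"
proof -
  obtain C where f: "f \<in> borel_measurable borel" "\<And>t. norm (f t) \<le> C" "\<And>t. f (t + 1) = f t"
    using assms(1) by (rule bounded_periodicE) blast
  show ?thesis
    by (rule bounded_periodicI[where C = C]) (auto simp: f(2,3) intro!: borel_measurable_continuous_on[OF _ f(1)] continuous_intros)
qed

lemma bounded_periodic_norm_power2:
  assumes "bounded_periodic f"
  shows "bounded_periodic (\<lambda>t. complex_of_real ((norm (f t))\<^sup>2))"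
  using bounded_periodic_mult[OF assms bounded_periodic_cnj[OF assms]]
  by (simp only: complex_norm_square)

lemma bounded_periodic_norm:
  assumes "bounded_periodic f"
  shows "bounded_periodic (\<lambda>t. complex_of_real (norm (f t)))"
proof -
  obtain C where f: "f \<in> borel_measurable borel" "\<And>t. norm (f t) \<le> C" "\<And>t. f (t + 1) = f t"
    using assms(1) by (rule bounded_periodicE) blast
  note [measurable] = f(1)
  show ?thesis
    by (rule bounded_periodicI[where C = C]) (auto simp: f(2,3))
qed

lemma bounded_periodic_shift:
  assumes "bounded_periodic f"
  shows "bounded_periodic (\<lambda>t. f (t + a))"
proof -
  obtain C where f: "f \<in> borel_measurable borel" "\<And>t. norm (f t) \<le> C" "\<And>t. f (t + 1) = f t"
    using assms(1) by (rule bounded_periodicE) blast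
  note [measurable] = f(1)
  have "f (t + 1 + a) = f (t + a)" for t using f(3)[of "t + a"] by (simp add: ac_simps)
  then show ?thesis
    by (intro bounded_periodicI[where C = C]) (auto simp: f(2,3))
qed

lemmas bounded_periodic_intros =
  bounded_periodic_const bounded_periodic_add bounded_periodic_mult bounded_periodic_diff
  bounded_periodic_sum bounded_periodic_cnj bounded_periodic_norm_power2 bounded_periodic_norm
  bounded_periodic_shift

lemma integrable_norm_power2:
  assumes "bounded_periodic f"
  shows "integrable unit_leb (\<lambda>t. (norm (f t))\<^sup>2)"
  using bounded_periodic_integrable[OF bounded_periodic_norm_power2[OF assms]]
  by (simp only: complex_of_real_integrable_eq)

text \<open>
  The interval \<open>{a..1 + a}\<close> is cut at 1, and periodicity carries the part beyond 1 back to \<open>{0..a}\<close>.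
\<close>

lemma integral_shift_periodic:
  assumes f: "bounded_periodic f" and a: "0 \<le> a" "a \<le> 1"
  shows "(LINT t|unit_leb. f (t + a)) = (LINT t|unit_leb. f t)"
proof -
  obtain C where C: "f \<in> borel_measurable borel" "\<And>t. norm (f t) \<le> C" "\<And>t. f (t + 1) = f t"
    using f by (rule bounded_periodicE) blast
  have int: "integrable (lebesgue_on {u..v}) f" for u v
    by (rule finite_measure.integrable_const_bound[OF finite_measure_lebesgue_on, of _ _ C])
       (auto simp: C(2) intro!: measurable_restrict_space1 measurable_completion C(1))
  have abs: "f integrable_on {u..v}" for u v
    using int[of u v] by (simp add: integrable_on_lebesgue_on)
  have shift: "integral {u..v} (\<lambda>t. f (t + b)) = integral {u + b..v + b} f" for u v b
    using has_integral_affinity'[OF integrable_integral[OF abs[of "u + b" "v + b", folded cbox_interval]],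
        of 1 b]
    by (intro integral_unique) simp
  have "(LINT t|unit_leb. f (t + a)) = integral {0..1} (\<lambda>t. f (t + a))"
    by (rule lebesgue_integral_eq_integral[OF bounded_periodic_integrable[OF bounded_periodic_shift[OF f]]]) auto
  also have "\<dots> = integral {a..1} f + integral {1..1 + a} f"
    using a by (simp add: shift Henstock_Kurzweil_Integration.integral_combine[OF _ _ abs])
  also have "integral {1..1 + a} f = integral {0..a} f"
    using shift[of 0 a 1] by (simp add: C(3) add.commute)
  also have "integral {a..1} f + integral {0..a} f = integral {0..1} f"
    using a Henstock_Kurzweil_Integration.integral_combine[OF _ _ abs, of 0 a 1] by (simp add: add.commute)
  also have "\<dots> = (LINT t|unit_leb. f t)"
    by (rule lebesgue_integral_eq_integral[OF int, symmetric]) auto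
  finally show ?thesis .
qed


section \<open>Exponentials and the discrete Fourier transform\<close>

lemma trig_cis: "trig m t = cis (2 * pi * (of_int m * t))"
  unfolding trig_def cis_conv_exp by (simp add: mult_ac)

lemma trig_0 [simp]: "trig 0 t = 1" "trig m 0 = 1"
  by (auto simp: trig_cis)

lemma trig_add_freq: "trig (m + n) t = trig m t * trig n t"
  by (simp add: trig_cis cis_mult algebra_simps)

lemma trig_add_time: "trig m (s + t) = trig m s * trig m t"
  by (simp add: trig_cis cis_mult algebra_simps)

lemma cnj_trig: "cnj (trig m t) = trig (- m) t"
  by (simp add: trig_cis cis_cnj)

lemma norm_trig [simp]: "norm (trig m t) = 1"
  by (simp add: trig_cis)

lemma trig_int [simp]: "trig m (of_int n) = 1"
  unfolding trig_cis of_int_mult[symmetric] by (rule cis_multiple_2pi) simp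

lemma trig_1 [simp]: "trig m 1 = 1"
  using trig_int[of m 1] by simp

lemma trig_power: "trig m (of_nat j * t) = trig m t ^ j"
  by (induction j) (auto simp: trig_add_time ring_distribs)

lemma trig_scale: "trig (m * n) t = trig m (of_int n * t)"
  by (simp add: trig_cis mult_ac)

lemma continuous_on_trig: "continuous_on S (trig m)"
  unfolding trig_def by (intro continuous_intros)

lemma bounded_periodic_trig: "bounded_periodic (trig m)"
  by (rule bounded_periodicI[where C = 1])
     (auto simp: trig_add_time intro!: borel_measurable_continuous_onI continuous_on_trig)

text \<open>
  Translation by half a period of \<open>trig m\<close> changes its sign but not its integral, so the integral
  vanishes for \<open>m \<noteq> 0\<close>.
\<close>

lemma integral_trig: "(LINT t|unit_leb. trig m t) = of_bool (m = 0)"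
proof (cases "m = 0")
  case True
  then show ?thesis using measure_unit_leb by simp
next
  case False
  \<comment> \<open>half a period\<close>
  define a where "a = 1 / (2 * \<bar>real_of_int m\<bar>)"
  have a: "0 \<le> a" "a \<le> 1" using False unfolding a_def by (auto simp: field_simps)
  have "2 * pi * (of_int m * a) = pi \<or> 2 * pi * (of_int m * a) = - pi"
    using False by (auto simp: a_def abs_if)
  then have *: "trig m a = - 1" unfolding trig_cis
    by (metis cis_pi cis_cnj complex_cnj_minus complex_cnj_one)
  have "(LINT t|unit_leb. trig m t) = (LINT t|unit_leb. trig m (t + a))"
    by (rule integral_shift_periodic[OF bounded_periodic_trig a, symmetric])
  also have "\<dots> = - (LINT t|unit_leb. trig m t)"
    by (simp add: trig_add_time *)
  finally show ?thesis using False by simp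
qed

lemma L2_inner_trig: "L2_inner (trig m) (trig n) = of_bool (m = n)"
proof -
  have "trig m t * cnj (trig n t) = trig (m - n) t" for t
    unfolding cnj_trig trig_add_freq[symmetric] by simp
  then show ?thesis by (simp add: L2_inner_def integral_trig)
qed

lemma sum_trig_roots_of_unity:
  assumes "0 < K"
  shows "(\<Sum>j<K. trig m (real j / real K)) = (if int K dvd m then of_nat K else 0)"
proof -
  define x where "x = trig m (1 / real K)"
  have p: "trig m (real j / real K) = x ^ j" for j
    using trig_power[of m j "1 / real K"] by (simp add: x_def)
  have "x = 1 \<longleftrightarrow> int K dvd m"
  proof
    assume "x = 1"
    then obtain n :: int where "2 * pi * of_int m / real K = of_int (2 * n) * pi"
      unfolding x_def trig_def exp_eq_1 by auto
    then have "real_of_int m = of_int (n * int K)" using assms by (simp add: field_simps)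
    then show "int K dvd m" by (simp only: of_int_eq_iff) simp
  next
    assume "int K dvd m"
    then obtain n where "m = n * int K" by (metis dvd_def mult.commute)
    then show "x = 1" using assms unfolding x_def by (simp add: trig_scale)
  qed
  moreover have "x ^ K = 1" using p[of K] assms by simp
  ultimately show ?thesis
    unfolding p by (auto simp: geometric_sum)
qed

text \<open>Parseval's identity for the discrete Fourier transform of length \<open>K\<close>.\<close>

lemma sum_norm_DFT:
  fixes a :: "nat \<Rightarrow> complex"
  assumes "0 < K"
  shows "(\<Sum>k<K. (norm (\<Sum>j<K. trig (- int k) (real j / real K) * a j))\<^sup>2)
    = real K * (\<Sum>j<K. (norm (a j))\<^sup>2)"
proof -
  have tr: "trig (- int k) (real i / real K) * trig (int k) (real j / real K)
      = trig (int j - int i) (real k / real K)" for i j k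
    unfolding trig_cis cis_mult by (simp add: algebra_simps diff_divide_distrib)
  have trm: "trig (- int k) (real i / real K) * a i * (trig (- (- int k)) (real j / real K) * cnj (a j))
      = trig (int j - int i) (real k / real K) * (a i * cnj (a j))" for i j k
    unfolding tr[symmetric] minus_minus by (simp only: mult_ac)
  have dvd: "int K dvd int j - int i \<longleftrightarrow> i = j" if "i < K" "j < K" for i j
    using that zdvd_imp_le[of "int K" "int j - int i"] zdvd_imp_le[of "int K" "int i - int j"]
    by (cases i j rule: linorder_cases) (auto simp: dvd_diff_commute)
  have "complex_of_real (\<Sum>k<K. (norm (\<Sum>j<K. trig (- int k) (real j / real K) * a j))\<^sup>2)
      = (\<Sum>k<K. \<Sum>i<K. \<Sum>j<K. trig (int j - int i) (real k / real K) * (a i * cnj (a j)))"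
    unfolding of_real_sum complex_norm_square cnj_sum sum_product complex_cnj_mult cnj_trig
    unfolding trm ..
  also have "\<dots> = (\<Sum>i<K. \<Sum>j<K. (\<Sum>k<K. trig (int j - int i) (real k / real K)) * (a i * cnj (a j)))"
    unfolding sum_distrib_right
    by (subst sum.swap, rule sum.cong[OF refl], subst sum.swap, rule refl)
  also have "\<dots> = (\<Sum>i<K. \<Sum>j<K. if i = j then of_nat K * (a i * cnj (a i)) else 0)"
    by (intro sum.cong refl) (auto simp: sum_trig_roots_of_unity[OF assms] dvd)
  also have "\<dots> = complex_of_real (real K * (\<Sum>j<K. (norm (a j))\<^sup>2))"
    unfolding of_real_mult of_real_sum complex_norm_square by (simp add: sum_distrib_left)
  finally show ?thesis by (simp only: of_real_eq_iff)
qed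

section \<open>The part of a function with frequencies in a residue class\<close>

text \<open>
  The closed form of the partial Fourier series over the frequencies congruent to \<open>k\<close> modulo \<open>K\<close>. For
  \<open>k = 0\<close> it is the Riemann sum of \<open>f\<close> over the points \<open>t + j/K\<close>.
\<close>

definition residue_part :: "nat \<Rightarrow> nat \<Rightarrow> (real \<Rightarrow> complex) \<Rightarrow> real \<Rightarrow> complex" where
  "residue_part K k f t = (\<Sum>j<K. trig (- int k) (real j / real K) * f (t + real j / real K)) / of_nat K"

lemma bounded_periodic_residue_part:
  assumes "bounded_periodic f"
  shows "bounded_periodic (residue_part K k f)"
proof -
  have "residue_part K k f = (\<lambda>t. inverse (of_nat K) *
      (\<Sum>j<K. trig (- int k) (real j / real K) * f (t + real j / real K)))"
    unfolding residue_part_def by (simp add: field_simps)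
  then show ?thesis
    by (auto intro!: bounded_periodic_intros assms)
qed

lemma sum_norm_residue_part:
  assumes "0 < K"
  shows "complex_of_real (\<Sum>k<K. (norm (residue_part K k f t))\<^sup>2)
    = residue_part K 0 (\<lambda>t. complex_of_real ((norm (f t))\<^sup>2)) t"
proof -
  have "(\<Sum>k<K. (norm (residue_part K k f t))\<^sup>2) = (\<Sum>j<K. (norm (f (t + real j / real K)))\<^sup>2) / real K"
    using assms sum_norm_DFT[OF assms, of "\<lambda>j. f (t + real j / real K)"]
    by (simp add: residue_part_def norm_divide power_divide sum_divide_distrib[symmetric] power2_eq_square)
  then show ?thesis by (simp add: residue_part_def)
qed

lemma L2_inner_shift_trig:
  assumes "bounded_periodic f" "0 \<le> a" "a \<le> 1"
  shows "L2_inner (\<lambda>t. f (t + a)) (trig m) = trig m a * L2_inner f (trig m)"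
proof -
  have "trig m a * trig (- m) (t + a) = trig (- m) t" for t
    by (simp add: trig_cis cis_mult algebra_simps)
  then have 1: "f (t + a) * trig (- m) t = trig m a * (f (t + a) * trig (- m) (t + a))" for t
    by (metis mult.left_commute)
  have "L2_inner (\<lambda>t. f (t + a)) (trig m) = (LINT t|unit_leb. trig m a * (f (t + a) * cnj (trig m (t + a))))"
    unfolding L2_inner_def cnj_trig 1 ..
  also have "\<dots> = trig m a * (LINT t|unit_leb. f (t + a) * cnj (trig m (t + a)))"
    by (rule integral_mult_right_zero)
  also have "(LINT t|unit_leb. f (t + a) * cnj (trig m (t + a))) = L2_inner f (trig m)"
    unfolding L2_inner_def
    by (rule integral_shift_periodic[OF bounded_periodic_mult[OF assms(1) bounded_periodic_cnj[OF bounded_periodic_trig]] assms(2,3)])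
  finally show ?thesis .
qed

text \<open>
  Translation by \<open>j/K\<close> multiplies the \<open>m\<close>-th coefficient by \<open>trig m (j/K)\<close>; the average of these factors
  against the character of \<open>k\<close> is a sum over roots of unity, which is 1 or 0 after normalization.
\<close>

lemma L2_inner_residue_part:
  assumes f: "bounded_periodic f" and K: "0 < K"
  shows "L2_inner (residue_part K k f) (trig m)
    = (if int K dvd m - int k then L2_inner f (trig m) else 0)"
proof -
  have int: "integrable unit_leb (\<lambda>t. f (t + a) * cnj (trig m t))" for a
    by (intro bounded_periodic_integrable bounded_periodic_intros f bounded_periodic_trig)
  have "L2_inner (residue_part K k f) (trig m)
      = (\<Sum>j<K. trig (- int k) (real j / real K) * L2_inner (\<lambda>t. f (t + real j / real K)) (trig m)) / of_nat K"
    unfolding L2_inner_def residue_part_def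
    by (simp add: sum_distrib_right int mult.assoc)
  also have "\<dots> = (\<Sum>j<K. trig (m - int k) (real j / real K)) * L2_inner f (trig m) / of_nat K"
    using K by (simp add: L2_inner_shift_trig[OF f] sum_distrib_right mult.assoc[symmetric]
       flip: trig_add_freq)
  finally show ?thesis using K by (simp add: sum_trig_roots_of_unity)
qed


section \<open>Density of trigonometric polynomials\<close>

definition trig_polynomial :: "(real \<Rightarrow> complex) \<Rightarrow> bool" where
  "trig_polynomial P \<longleftrightarrow> (\<exists>F c. finite F \<and> P = (\<lambda>t. \<Sum>m\<in>F. c m * trig m t))"

lemma trig_polynomialE:
  assumes "trig_polynomial P"
  obtains F c where "finite F" "P = (\<lambda>t. \<Sum>m\<in>F. c m * trig m t)"
  using assms unfolding trig_polynomial_def by blast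

lemma trig_polynomial_monomial: "trig_polynomial (\<lambda>t. c * trig m t)"
  unfolding trig_polynomial_def by (rule exI[of _ "{m}"], rule exI[of _ "\<lambda>_. c"]) simp

lemma trig_polynomial_const: "trig_polynomial (\<lambda>t. c)"
  using trig_polynomial_monomial[of c 0] by simp

lemma trig_polynomial_add:
  assumes "trig_polynomial P" "trig_polynomial Q"
  shows "trig_polynomial (\<lambda>t. P t + Q t)"
proof -
  obtain F c where F: "finite F" and P: "P = (\<lambda>t. \<Sum>m\<in>F. c m * trig m t)"
    using assms(1) by (rule trig_polynomialE)
  obtain G d where G: "finite G" and Q: "Q = (\<lambda>t. \<Sum>m\<in>G. d m * trig m t)"
    using assms(2) by (rule trig_polynomialE)
  define e where "e m = (if m \<in> F then c m else 0) + (if m \<in> G then d m else 0)" for m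
  have "P t = (\<Sum>m\<in>F \<union> G. (if m \<in> F then c m else 0) * trig m t)" for t
    unfolding P using F G by (intro sum.mono_neutral_cong_left) auto
  moreover have "Q t = (\<Sum>m\<in>F \<union> G. (if m \<in> G then d m else 0) * trig m t)" for t
    unfolding Q using F G by (intro sum.mono_neutral_cong_left) auto
  ultimately have "(\<lambda>t. P t + Q t) = (\<lambda>t. \<Sum>m\<in>F \<union> G. e m * trig m t)"
    by (simp add: e_def ring_distribs sum.distrib)
  then show ?thesis using F G unfolding trig_polynomial_def by blast
qed

lemma trig_polynomial_sum:
  assumes "\<And>i. i \<in> A \<Longrightarrow> trig_polynomial (P i)"
  shows "trig_polynomial (\<lambda>t. \<Sum>i\<in>A. P i t)"
  using assms
  by (induction A rule: infinite_finite_induct)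
     (auto intro: trig_polynomial_const trig_polynomial_add)

lemma trig_polynomial_mult:
  assumes "trig_polynomial P" "trig_polynomial Q"
  shows "trig_polynomial (\<lambda>t. P t * Q t)"
proof -
  obtain F c where P: "P = (\<lambda>t. \<Sum>m\<in>F. c m * trig m t)"
    using assms(1) by (rule trig_polynomialE)
  obtain G d where Q: "Q = (\<lambda>t. \<Sum>m\<in>G. d m * trig m t)"
    using assms(2) by (rule trig_polynomialE)
  have "(\<lambda>t. P t * Q t) = (\<lambda>t. \<Sum>m\<in>F. \<Sum>n\<in>G. (c m * d n) * trig (m + n) t)"
    unfolding P Q sum_product trig_add_freq by (simp add: mult_ac)
  then show ?thesis
    by (auto intro!: trig_polynomial_sum trig_polynomial_monomial)
qed

lemma trig_polynomial_bounded_periodic: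
  assumes "trig_polynomial P"
  shows "bounded_periodic P"
  using assms by (elim trig_polynomialE) (auto intro!: bounded_periodic_intros bounded_periodic_trig)

text \<open>
  On the unit circle the real and imaginary part of \<open>z\<close> are combinations of \<open>z\<close> and its inverse, so a
  polynomial in the two real coordinates becomes a trigonometric polynomial.
\<close>

lemma trig_polynomial_real_polynomial_function:
  assumes "real_polynomial_function p"
  shows "trig_polynomial (\<lambda>t. complex_of_real (p (trig 1 t)))"
  using assms
proof induction
  case (linear p)
  interpret p: bounded_linear p by fact
  have p_eq: "p z = Re z * p 1 + Im z * p \<i>" for z
  proof -
    have "p z = p (Re z *\<^sub>R 1 + Im z *\<^sub>R \<i>)"
      by (rule arg_cong[of _ _ p]) (simp add: complex_eq_iff)
    then show ?thesis by (simp only: p.add p.scaleR real_scaleR_def)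
  qed
  have "complex_of_real (p (trig 1 t))
      = ((p 1 - \<i> * p \<i>) / 2) * trig 1 t + ((p 1 + \<i> * p \<i>) / 2) * trig (- 1) t" for t
    unfolding p_eq[of "trig 1 t"] by (simp add: trig_cis complex_eq_iff field_simps)
  then show ?case
    by (simp only:) (intro trig_polynomial_add trig_polynomial_monomial)
next
  case (const c)
  then show ?case by (rule trig_polynomial_const)
next
  case (add p q)
  then show ?case using trig_polynomial_add by simp
next
  case (mult p q)
  then show ?case using trig_polynomial_mult by simp
qed

text \<open>
  The map \<open>trig 1\<close> from the compact interval onto the circle is a quotient map whose only identification
  is that of the two endpoints.
\<close>

lemma continuous_periodic_lift_to_circle:
  fixes h :: "real \<Rightarrow> complex"
  assumes "continuous_on {0..1} h" "h 0 = h 1"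
  obtains H where "continuous_on (sphere 0 1) H" "\<And>t. t \<in> {0..1} \<Longrightarrow> H (trig 1 t) = h t"
proof -
  have img: "trig 1 ` {0..1} = sphere 0 1"
  proof (intro equalityI subsetI)
    fix z :: complex assume "z \<in> sphere 0 1"
    then have "exp (\<i> * of_real (Arg2pi z)) = z" by (simp add: complex_norm_eq_1_exp)
    then have "z = trig 1 (Arg2pi z / (2 * pi))" by (simp add: trig_def)
    moreover have "Arg2pi z / (2 * pi) \<in> {0..1}"
      using Arg2pi_ge_0[of z] Arg2pi_lt_2pi[of z] by simp
    ultimately show "z \<in> trig 1 ` {0..1}" by blast
  qed auto
  have q: "quotient_map (top_of_set {0..1}) (top_of_set (sphere 0 1)) (trig 1)"
    by (rule T1_Spaces.continuous_imp_quotient_map)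
       (auto simp: img compact_space_subtopology Hausdorff_space_subtopology continuous_on_trig)
  have inj: "h x = h y" if "x \<in> {0..1}" "y \<in> {0..1}" "trig 1 x = trig 1 y" for x y
  proof -
    obtain n :: int where "2 * of_real pi * \<i> * of_real x = 2 * of_real pi * \<i> * of_real y + of_int (2 * n) * pi * \<i>"
      using \<open>trig 1 x = trig 1 y\<close> unfolding trig_def exp_eq by auto
    then have "pi * x = pi * (y + of_int n)"
      by (simp add: complex_eq_iff algebra_simps)
    then have n: "x = y + of_int n" by simp
    with that have "n \<le> 1" "-1 \<le> n" by auto
    then consider "n = 0" | "n = 1" | "n = - 1" by linarith
    then show ?thesis using n that assms(2) by cases auto
  qed
  have h: "continuous_map (top_of_set {0..1}) euclidean h" using assms(1) by simp
  show ?thesis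
  proof (rule quotient_map_lift_exists[OF q h])
    show "h x = h y"
      if "x \<in> topspace (top_of_set {0..1})" "y \<in> topspace (top_of_set {0..1})" "trig 1 x = trig 1 y" for x y
      using that by (intro inj) auto
  next
    fix H
    assume "continuous_map (top_of_set (sphere 0 1)) euclidean H"
      "\<And>t. t \<in> topspace (top_of_set {0..1}) \<Longrightarrow> H (trig 1 t) = h t"
    then show thesis by (intro that) auto
  qed
qed

lemma trig_polynomial_uniform_approx:
  fixes h :: "real \<Rightarrow> complex"
  assumes "continuous_on {0..1} h" "h 0 = h 1" "0 < e"
  obtains P where "trig_polynomial P" "\<And>t. t \<in> {0..1} \<Longrightarrow> norm (h t - P t) < e"
proof -
  obtain H where H: "continuous_on (sphere 0 1) H" "\<And>t. t \<in> {0..1} \<Longrightarrow> H (trig 1 t) = h t"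
    using continuous_periodic_lift_to_circle[OF assms(1,2)] by blast
  obtain p where p: "real_polynomial_function p" "\<And>z. z \<in> sphere 0 1 \<Longrightarrow> \<bar>Re (H z) - p z\<bar> < e / 2"
    using Stone_Weierstrass_real_polynomial_function[OF compact_sphere continuous_on_Re[OF H(1)], of "e / 2"]
      assms(3) by auto
  obtain q where q: "real_polynomial_function q" "\<And>z. z \<in> sphere 0 1 \<Longrightarrow> \<bar>Im (H z) - q z\<bar> < e / 2"
    using Stone_Weierstrass_real_polynomial_function[OF compact_sphere continuous_on_Im[OF H(1)], of "e / 2"]
      assms(3) by auto
  show ?thesis
  proof
    show "trig_polynomial (\<lambda>t. complex_of_real (p (trig 1 t)) + \<i> * complex_of_real (q (trig 1 t)))"
      by (intro trig_polynomial_add trig_polynomial_mult trig_polynomial_const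
          trig_polynomial_real_polynomial_function p q)
    fix t :: real assume t: "t \<in> {0..1}"
    have "norm (h t - (complex_of_real (p (trig 1 t)) + \<i> * complex_of_real (q (trig 1 t))))
        \<le> \<bar>Re (h t) - p (trig 1 t)\<bar> + \<bar>Im (h t) - q (trig 1 t)\<bar>"
      by (rule order_trans[OF cmod_le]) simp
    also have "\<dots> < e"
      using p(2)[of "trig 1 t"] q(2)[of "trig 1 t"] by (simp add: H(2)[OF t])
    finally show "norm (h t - (complex_of_real (p (trig 1 t)) + \<i> * complex_of_real (q (trig 1 t)))) < e" .
  qed
qed

lemma norm_add_power2_le:
  fixes a b :: "'a::real_normed_vector"
  shows "(norm (a + b))\<^sup>2 \<le> 2 * (norm a)\<^sup>2 + 2 * (norm b)\<^sup>2"
proof -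
  have "(norm (a + b))\<^sup>2 \<le> (norm a + norm b)\<^sup>2"
    by (intro power_mono norm_triangle_ineq) simp
  also have "\<dots> \<le> 2 * (norm a)\<^sup>2 + 2 * (norm b)\<^sup>2"
    using sum_squares_bound[of "norm a" "norm b"] by (simp add: power2_sum)
  finally show ?thesis .
qed

text \<open>
  A measurable function is an almost everywhere limit of continuous functions. Projecting these to the
  disc of radius \<open>C\<close> gives a uniform bound for dominated convergence, and multiplying by a cutoff that
  vanishes at the two endpoints makes them periodic without disturbing the limit inside the interval.
\<close>

lemma continuous_L2_approx:
  assumes f: "bounded_periodic f" and e: "0 < e"
  obtains h where "continuous_on UNIV h" "h 0 = h 1" "(LINT t|unit_leb. (norm (f t - h t))\<^sup>2) < e"
proof -
  obtain C where C: "f \<in> borel_measurable borel" "\<And>t. norm (f t) \<le> C" "\<And>t. f (t + 1) = f t"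
    using f by (rule bounded_periodicE) blast
  have C0: "0 \<le> C" using order_trans[OF norm_ge_zero C(2)] .
  have "f measurable_on UNIV"
    using C(1) by (subst measurable_on_iff_borel_measurable) (auto simp: lebesgue_on_UNIV_eq intro: measurable_completion)
  then obtain N g where N: "negligible N" and g: "\<And>n::nat. continuous_on UNIV (g n)"
      and lim: "\<And>x. x \<notin> N \<Longrightarrow> (\<lambda>n. g n x) \<longlonglongrightarrow> f x"
    unfolding measurable_on_def by auto
  \<comment> \<open>\<open>\<pi>\<close> truncates to the disc; \<open>\<phi> n\<close> vanishes at 0 and 1 and is 1 at distance at least \<open>1/n\<close> from them\<close>
  define \<pi> where "\<pi> = closest_point (cball (0::complex) C)"
  define \<phi> where "\<phi> n t = min 1 (real n * max 0 (min t (1 - t)))" for n :: nat and t :: real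
  define h where "h n t = complex_of_real (\<phi> n t) * \<pi> (g n t)" for n t
  have cont_\<pi>: "continuous_on UNIV \<pi>"
    unfolding \<pi>_def using C0 by (intro continuous_on_closest_point) auto
  have norm_\<pi>: "norm (\<pi> z) \<le> C" for z
    using closest_point_in_set[of "cball (0::complex) C" z] C0 by (simp add: \<pi>_def)
  have \<phi>: "0 \<le> \<phi> n t" "\<phi> n t \<le> 1" for n t unfolding \<phi>_def by auto
  have cont_h: "continuous_on UNIV (h n)" for n
    unfolding h_def \<phi>_def
    by (intro continuous_intros continuous_on_compose2[OF cont_\<pi> g]) auto
  have norm_h: "norm (h n t) \<le> C" for n t
    unfolding h_def norm_mult using mult_mono[OF \<phi>(2)[of n t] norm_\<pi>[of "g n t"]] \<phi>[of n t] by simp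
  have \<phi>_lim: "(\<lambda>n. \<phi> n t) \<longlonglongrightarrow> 1" if t: "0 < t" "t < 1" for t
  proof (rule tendsto_eventually)
    define d where "d = min t (1 - t)"
    have "eventually (\<lambda>n. 1 / d \<le> real n) sequentially"
      using filterlim_real_sequentially by (simp add: filterlim_at_top)
    then show "eventually (\<lambda>n. \<phi> n t = 1) sequentially"
    proof eventually_elim
      case (elim n)
      then show ?case using t unfolding \<phi>_def d_def[symmetric] by (simp add: d_def field_simps)
    qed
  qed
  have h_lim: "(\<lambda>n. h n t) \<longlonglongrightarrow> f t" if t: "0 < t" "t < 1" "t \<notin> N" for t
  proof -
    have "(\<lambda>n. \<pi> (g n t)) \<longlonglongrightarrow> \<pi> (f t)"
      using cont_\<pi> lim[OF t(3)] by (rule continuous_on_tendsto_compose) auto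
    moreover have "\<pi> (f t) = f t" unfolding \<pi>_def using C(2) by (intro closest_point_self) simp
    ultimately have "(\<lambda>n. \<pi> (g n t)) \<longlonglongrightarrow> f t" by simp
    from tendsto_mult[OF tendsto_of_real[OF \<phi>_lim[OF t(1,2)]] this]
    show ?thesis by (simp add: h_def)
  qed
  have "AE t in unit_leb. t \<notin> N \<union> {0, 1}"
  proof (subst AE_restrict_space_iff)
    have "N \<union> {0, 1} \<in> null_sets lebesgue"
      using N by (auto simp: negligible_iff_null_sets[symmetric] negligible_insert)
    then show "AE t in lebesgue. t \<in> {0..1} \<longrightarrow> t \<notin> N \<union> {0, 1}"
      by (rule AE_I') auto
  qed auto
  then have AE: "AE t in unit_leb. (\<lambda>n. (norm (f t - h n t))\<^sup>2) \<longlonglongrightarrow> 0"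
  proof (rule AE_mp, intro AE_I2 impI)
    fix t assume "t \<in> space unit_leb" "t \<notin> N \<union> {0, 1}"
    then have "(\<lambda>n. h n t) \<longlonglongrightarrow> f t" by (intro h_lim) (auto simp: less_le)
    then have "(\<lambda>n. (norm (f t - h n t))\<^sup>2) \<longlonglongrightarrow> (norm (f t - f t))\<^sup>2"
      by (intro tendsto_intros)
    then show "(\<lambda>n. (norm (f t - h n t))\<^sup>2) \<longlonglongrightarrow> 0" by simp
  qed
  have bound: "norm ((norm (f t - h n t))\<^sup>2) \<le> (2 * C)\<^sup>2" for n t
  proof -
    have "norm (f t - h n t) \<le> 2 * C"
      using norm_triangle_ineq4[of "f t" "h n t"] C(2)[of t] norm_h[of n t] by linarith
    then have "(norm (f t - h n t))\<^sup>2 \<le> (2 * C)\<^sup>2" by (rule power_mono) simp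
    then show ?thesis by simp
  qed
  have "(\<lambda>n. LINT t|unit_leb. (norm (f t - h n t))\<^sup>2) \<longlonglongrightarrow> (LINT t|unit_leb. 0)"
  proof (rule integral_dominated_convergence[where w = "\<lambda>_. (2 * C)\<^sup>2"])
    show "(\<lambda>t. (norm (f t - h n t))\<^sup>2) \<in> borel_measurable unit_leb" for n
      using C(1) borel_measurable_continuous_onI[OF cont_h]
      by (intro borel_imp_measurable_unit_leb) measurable
    show "integrable unit_leb (\<lambda>_. (2 * C)\<^sup>2)"
      by (rule finite_measure.integrable_const[OF finite_measure_unit_leb])
  qed (use AE bound in auto)
  then have "(\<lambda>n. LINT t|unit_leb. (norm (f t - h n t))\<^sup>2) \<longlonglongrightarrow> 0" by simp
  then have "eventually (\<lambda>n. (LINT t|unit_leb. (norm (f t - h n t))\<^sup>2) < e) sequentially"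
    using e by (rule order_tendstoD(2))
  then obtain n where "(LINT t|unit_leb. (norm (f t - h n t))\<^sup>2) < e"
    by (auto dest: eventually_happens)
  moreover have "h n 0 = h n 1" unfolding h_def \<phi>_def by simp
  ultimately show ?thesis using that cont_h by blast
qed

lemma trig_polynomial_L2_dense:
  assumes f: "bounded_periodic f" and e: "0 < e"
  obtains P where "trig_polynomial P" "(LINT t|unit_leb. (norm (f t - P t))\<^sup>2) < e"
proof -
  obtain h where h: "continuous_on UNIV h" "h 0 = h 1" "(LINT t|unit_leb. (norm (f t - h t))\<^sup>2) < e / 4"
    using continuous_L2_approx[OF f, of "e / 4"] e by auto
  obtain P where P: "trig_polynomial P" "\<And>t. t \<in> {0..1} \<Longrightarrow> norm (h t - P t) < sqrt (e / 4)"
    using trig_polynomial_uniform_approx[OF continuous_on_subset[OF h(1)] h(2), of "sqrt (e / 4)"] e by auto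
  obtain C where C: "f \<in> borel_measurable borel" "\<And>t. norm (f t) \<le> C" "\<And>t. f (t + 1) = f t"
    using f by (rule bounded_periodicE) blast
  have "compact (h ` {0..1})" using h(1) by (intro compact_continuous_image) (auto intro: continuous_on_subset)
  then obtain D where D: "\<And>t. t \<in> {0..1} \<Longrightarrow> norm (h t) \<le> D"
    by (meson compact_imp_bounded bounded_iff imageI)
  have int: "integrable unit_leb (\<lambda>t. (norm (f t - h t))\<^sup>2)"
  proof (rule finite_measure.integrable_const_bound[OF finite_measure_unit_leb, of _ "(C + D)\<^sup>2"])
    show "(\<lambda>t. (norm (f t - h t))\<^sup>2) \<in> borel_measurable unit_leb"
      using C(1) borel_measurable_continuous_onI[OF h(1)]
      by (intro borel_imp_measurable_unit_leb) measurable
    have "norm (f t - h t) \<le> C + D" if "t \<in> {0..1}" for t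
      using norm_triangle_ineq4[of "f t" "h t"] C(2)[of t] D[OF that] by linarith
    then show "AE t in unit_leb. norm ((norm (f t - h t))\<^sup>2) \<le> (C + D)\<^sup>2"
      by (auto intro!: AE_I2 power_mono)
  qed
  have "(norm (f t - P t))\<^sup>2 \<le> 2 * (norm (f t - h t))\<^sup>2 + e / 2" if "t \<in> {0..1}" for t
  proof -
    have "(norm (h t - P t))\<^sup>2 \<le> (sqrt (e / 4))\<^sup>2"
      using P(2)[OF that] by (intro power_mono) auto
    then show ?thesis using norm_add_power2_le[of "f t - h t" "h t - P t"] e by simp
  qed
  then have "(LINT t|unit_leb. (norm (f t - P t))\<^sup>2) \<le> (LINT t|unit_leb. 2 * (norm (f t - h t))\<^sup>2 + e / 2)"
    by (intro integral_mono integrable_norm_power2 bounded_periodic_diff f trig_polynomial_bounded_periodic P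
        Bochner_Integration.integrable_add integrable_mult_right int
        finite_measure.integrable_const[OF finite_measure_unit_leb]) auto
  also have "\<dots> = 2 * (LINT t|unit_leb. (norm (f t - h t))\<^sup>2) + e / 2"
    using measure_unit_leb int finite_measure.integrable_const[OF finite_measure_unit_leb] by simp
  also have "\<dots> < e" using h(3) by simp
  finally show ?thesis using that P(1) by blast
qed


section \<open>Fourier series of residue parts\<close>

lemma L2_inner_trig_polynomial_right:
  assumes "bounded_periodic f"
  shows "(LINT t|unit_leb. f t * cnj (\<Sum>m\<in>F. d m * trig m t)) = (\<Sum>m\<in>F. cnj (d m) * L2_inner f (trig m))"
proof -
  have int: "integrable unit_leb (\<lambda>t. f t * cnj (trig m t))" for m
    by (intro bounded_periodic_integrable bounded_periodic_intros assms bounded_periodic_trig)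
  have "f t * cnj (\<Sum>m\<in>F. d m * trig m t) = (\<Sum>m\<in>F. cnj (d m) * (f t * cnj (trig m t)))" for t
    by (simp add: cnj_sum sum_distrib_left mult_ac)
  then show ?thesis by (simp add: L2_inner_def int)
qed

text \<open>
  Orthonormality completes the square in the coefficients, so that among the trigonometric polynomials
  with frequencies in \<open>F\<close> the partial Fourier sum is the closest to \<open>f\<close>.
\<close>

lemma L2_distance_trig_polynomial:
  assumes f: "bounded_periodic f" and F: "finite F"
  shows "(LINT t|unit_leb. (norm (f t - (\<Sum>m\<in>F. d m * trig m t)))\<^sup>2)
    = (LINT t|unit_leb. (norm (f t))\<^sup>2) - (\<Sum>m\<in>F. (norm (L2_inner f (trig m)))\<^sup>2)
      + (\<Sum>m\<in>F. (norm (L2_inner f (trig m) - d m))\<^sup>2)"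
proof -
  define Q where "Q t = (\<Sum>m\<in>F. d m * trig m t)" for t
  define c where "c m = L2_inner f (trig m)" for m
  have Q: "bounded_periodic Q"
    unfolding Q_def by (intro bounded_periodic_intros bounded_periodic_trig)
  have int: "integrable unit_leb (\<lambda>t. u t * cnj (v t))" if "bounded_periodic u" "bounded_periodic v" for u v
    by (intro bounded_periodic_integrable bounded_periodic_intros that)
  have fQ: "(LINT t|unit_leb. f t * cnj (Q t)) = (\<Sum>m\<in>F. cnj (d m) * c m)"
    unfolding Q_def c_def by (rule L2_inner_trig_polynomial_right[OF f])
  have "(LINT t|unit_leb. Q t * cnj (f t)) = (LINT t|unit_leb. cnj (f t * cnj (Q t)))"
    by (simp add: mult.commute)
  also have "\<dots> = (\<Sum>m\<in>F. d m * cnj (c m))"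
    unfolding Bochner_Integration.integral_cnj fQ by (simp add: cnj_sum)
  finally have Qf: "(LINT t|unit_leb. Q t * cnj (f t)) = (\<Sum>m\<in>F. d m * cnj (c m))" .
  have "L2_inner Q (trig n) = d n" if "n \<in> F" for n
  proof -
    have "L2_inner Q (trig n) = (\<Sum>m\<in>F. d m * L2_inner (trig m) (trig n))"
      unfolding L2_inner_def Q_def sum_distrib_right mult.assoc
      by (simp add: int bounded_periodic_trig)
    then show ?thesis using that F by (simp add: L2_inner_trig of_bool_def if_distrib[of "(*) _"] cong: if_cong)
  qed
  then have QQ: "(LINT t|unit_leb. Q t * cnj (Q t)) = (\<Sum>m\<in>F. cnj (d m) * d m)"
    using L2_inner_trig_polynomial_right[OF Q, of d F] by (simp flip: Q_def)
  have "complex_of_real (LINT t|unit_leb. (norm (f t - Q t))\<^sup>2)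
      = (LINT t|unit_leb. f t * cnj (f t) - f t * cnj (Q t) - Q t * cnj (f t) + Q t * cnj (Q t))"
    unfolding integral_complex_of_real[symmetric] complex_norm_square
    by (simp add: algebra_simps)
  also have "\<dots> = (LINT t|unit_leb. f t * cnj (f t)) - (\<Sum>m\<in>F. cnj (d m) * c m)
      - (\<Sum>m\<in>F. d m * cnj (c m)) + (\<Sum>m\<in>F. cnj (d m) * d m)"
    by (simp add: int f Q fQ Qf QQ)
  also have "\<dots> = (LINT t|unit_leb. f t * cnj (f t)) - (\<Sum>m\<in>F. c m * cnj (c m))
      + (\<Sum>m\<in>F. (c m - d m) * cnj (c m - d m))"
    by (simp add: algebra_simps sum.distrib sum_subtractf)
  also have "\<dots> = complex_of_real ((LINT t|unit_leb. (norm (f t))\<^sup>2) - (\<Sum>m\<in>F. (norm (c m))\<^sup>2)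
      + (\<Sum>m\<in>F. (norm (c m - d m))\<^sup>2))"
    unfolding of_real_add of_real_diff of_real_sum integral_complex_of_real[symmetric] complex_norm_square ..
  finally show ?thesis unfolding of_real_eq_iff Q_def c_def .
qed

lemma fourier_sum_best_approx:
  assumes "bounded_periodic f" "finite F"
  shows "(LINT t|unit_leb. (norm (f t - (\<Sum>m\<in>F. L2_inner f (trig m) * trig m t)))\<^sup>2)
    \<le> (LINT t|unit_leb. (norm (f t - (\<Sum>m\<in>F. d m * trig m t)))\<^sup>2)"
  unfolding L2_distance_trig_polynomial[OF assms] by (simp add: sum_nonneg)

lemma bounded_periodic_in_L2: "bounded_periodic f \<Longrightarrow> in_L2 f"
  unfolding in_L2_def
  by (auto intro: integrable_norm_power2 borel_imp_measurable_unit_leb elim: bounded_periodicE)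

text \<open>
  Given an approximating trigonometric polynomial with frequency set \<open>G\<close>, any finite set of indices that
  covers the frequencies of \<open>G\<close> in the residue class does at least as well: the frequencies of \<open>G\<close>
  outside the class can be added to the sum, since the residue part has coefficient 0 there, and then
  the best approximation property applies.
\<close>

lemma has_L2_sum_residue_part:
  assumes f: "bounded_periodic f" and K: "0 < K"
  shows "has_L2_sum (\<lambda>n t. L2_inner f (trig (n * int K + int k)) * trig (n * int K + int k) t)
    (residue_part K k f)"
  unfolding has_L2_sum_def
proof (intro conjI allI)
  define h where "h = residue_part K k f"
  define \<iota> where "\<iota> n = n * int K + int k" for n
  define u where "u n t = L2_inner f (trig (\<iota> n)) * trig (\<iota> n) t" for n t
  have h: "bounded_periodic h" unfolding h_def by (rule bounded_periodic_residue_part[OF f])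
  have "in_L2 (u n)" for n
    unfolding u_def by (intro bounded_periodic_in_L2 bounded_periodic_intros bounded_periodic_trig)
  then show "in_L2 (\<lambda>t. L2_inner f (trig (n * int K + int k)) * trig (n * int K + int k) t)" for n
    unfolding u_def \<iota>_def .
  show "in_L2 (residue_part K k f)" using bounded_periodic_in_L2[OF h] by (simp add: h_def)
  have inj: "inj \<iota>" unfolding \<iota>_def inj_on_def using K by simp
  have coeff: "L2_inner h (trig (\<iota> n)) = L2_inner f (trig (\<iota> n))" for n
    unfolding h_def L2_inner_residue_part[OF f K] by (simp add: \<iota>_def)
  have coeff_0: "L2_inner h (trig m) = 0" if "m \<notin> range \<iota>" for m
  proof -
    have "\<not> int K dvd m - int k"
    proof
      assume "int K dvd m - int k"
      then obtain n where "m - int k = int K * n" by (rule dvdE)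
      then have "m = \<iota> n" by (simp add: \<iota>_def algebra_simps)
      with that show False by blast
    qed
    then show ?thesis unfolding h_def L2_inner_residue_part[OF f K] by simp
  qed
  have "((\<lambda>F. L2_norm (\<lambda>t. (\<Sum>n\<in>F. u n t) - h t)) \<longlongrightarrow> 0) (finite_subsets_at_top UNIV)"
  proof (rule tendstoI)
    fix e :: real assume e: "0 < e"
    obtain P where "trig_polynomial P" and P: "(LINT t|unit_leb. (norm (h t - P t))\<^sup>2) < e\<^sup>2"
      using trig_polynomial_L2_dense[OF h, of "e\<^sup>2"] e by auto
    then obtain G c where G: "finite G" and P_eq: "P = (\<lambda>t. \<Sum>m\<in>G. c m * trig m t)"
      by (elim trig_polynomialE)
    have close: "dist (L2_norm (\<lambda>t. (\<Sum>n\<in>F. u n t) - h t)) 0 < e"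
      if F: "finite F" "\<iota> -` G \<subseteq> F" for F
    proof -
      define H where "H = \<iota> ` F \<union> G"
      have H: "finite H" using F(1) G by (simp add: H_def)
      have "(\<Sum>n\<in>F. u n t) = (\<Sum>m\<in>\<iota> ` F. L2_inner h (trig m) * trig m t)" for t
        using inj by (subst sum.reindex) (auto simp: coeff u_def inj_on_def)
      also have "(\<Sum>m\<in>\<iota> ` F. L2_inner h (trig m) * trig m t) = (\<Sum>m\<in>H. L2_inner h (trig m) * trig m t)" for t
      proof (rule sum.mono_neutral_left[OF H])
        show "\<forall>m\<in>H - \<iota> ` F. L2_inner h (trig m) * trig m t = 0"
        proof
          fix m assume "m \<in> H - \<iota> ` F"
          then have "m \<notin> range \<iota>" using F(2) by (auto simp: H_def)
          then show "L2_inner h (trig m) * trig m t = 0" by (simp add: coeff_0)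
        qed
      qed (simp add: H_def)
      finally have u_eq: "(\<Sum>n\<in>F. u n t) = (\<Sum>m\<in>H. L2_inner h (trig m) * trig m t)" for t .
      have P_eq': "P t = (\<Sum>m\<in>H. (if m \<in> G then c m else 0) * trig m t)" for t
        unfolding P_eq using H by (intro sum.mono_neutral_cong_left) (auto simp: H_def)
      have "(LINT t|unit_leb. (norm ((\<Sum>n\<in>F. u n t) - h t))\<^sup>2) \<le> (LINT t|unit_leb. (norm (h t - P t))\<^sup>2)"
        unfolding u_eq P_eq' norm_minus_commute[of "sum _ _" "h _"]
        by (rule fourier_sum_best_approx[OF h H])
      with P have "(LINT t|unit_leb. (norm ((\<Sum>n\<in>F. u n t) - h t))\<^sup>2) < e\<^sup>2" by simp
      then have "L2_norm (\<lambda>t. (\<Sum>n\<in>F. u n t) - h t) < e"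
        unfolding L2_norm_def using e by (simp add: real_less_lsqrt)
      then show ?thesis by (simp add: L2_norm_def)
    qed
    have "finite (\<iota> -` G)" using G inj by (rule finite_vimageI)
    then show "\<forall>\<^sub>F F in finite_subsets_at_top UNIV. dist (L2_norm (\<lambda>t. (\<Sum>n\<in>F. u n t) - h t)) 0 < e"
      unfolding eventually_finite_subsets_at_top
      by (intro exI[of _ "\<iota> -` G"] conjI allI impI close) auto
  qed
  then show "((\<lambda>F. L2_norm (\<lambda>t. (\<Sum>n\<in>F. L2_inner f (trig (n * int K + int k)) * trig (n * int K + int k) t)
      - residue_part K k f t)) \<longlongrightarrow> 0) (finite_subsets_at_top UNIV)"
    unfolding u_def h_def \<iota>_def .
qed

lemma in_L2_add:
  assumes "in_L2 f" "in_L2 g"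
  shows "in_L2 (\<lambda>t. f t + g t)"
proof -
  have m[measurable]: "f \<in> borel_measurable unit_leb" "g \<in> borel_measurable unit_leb"
    using assms by (auto simp: in_L2_def)
  have "integrable unit_leb (\<lambda>t. 2 * (norm (f t))\<^sup>2 + 2 * (norm (g t))\<^sup>2)"
    using assms by (auto simp: in_L2_def)
  then have "integrable unit_leb (\<lambda>t. (norm (f t + g t))\<^sup>2)"
    by (rule Bochner_Integration.integrable_bound)
       (auto intro!: AE_I2 order_trans[OF norm_add_power2_le])
  then show ?thesis by (simp add: in_L2_def)
qed

lemma in_L2_diff: "in_L2 f \<Longrightarrow> in_L2 g \<Longrightarrow> in_L2 (\<lambda>t. f t - g t)"
  using in_L2_add[of f "\<lambda>t. - g t"] by (simp add: in_L2_def)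

lemma in_L2_sum:
  assumes "\<And>i. i \<in> A \<Longrightarrow> in_L2 (u i)"
  shows "in_L2 (\<lambda>t. \<Sum>i\<in>A. u i t)"
  using assms
proof (induction A rule: infinite_finite_induct)
  case (insert i A)
  then show ?case by (simp add: in_L2_add)
qed (simp_all add: in_L2_def)

lemma L2_norm_power2: "(L2_norm f)\<^sup>2 = (LINT t|unit_leb. (norm (f t))\<^sup>2)"
  unfolding L2_norm_def by (simp add: integral_nonneg_AE)

lemma has_L2_sum_unique:
  assumes "has_L2_sum u h" "has_L2_sum u h'"
  shows "AE t in unit_leb. h t = h' t"
proof -
  have L2: "in_L2 (u n)" "in_L2 h" "in_L2 h'" for n
    using assms by (auto simp: has_L2_sum_def)
  define S where "S F t = (\<Sum>n\<in>F. u n t)" for F t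
  have S: "in_L2 (S F)" for F unfolding S_def by (intro in_L2_sum L2)
  have int: "integrable unit_leb (\<lambda>t. (norm (f t - g t))\<^sup>2)" if "in_L2 f" "in_L2 g" for f g
    using in_L2_diff[OF that] by (simp add: in_L2_def)
  have le: "(LINT t|unit_leb. (norm (h t - h' t))\<^sup>2)
      \<le> 2 * (L2_norm (\<lambda>t. S F t - h t))\<^sup>2 + 2 * (L2_norm (\<lambda>t. S F t - h' t))\<^sup>2" for F
  proof -
    have "(norm (h t - h' t))\<^sup>2 \<le> 2 * (norm (S F t - h t))\<^sup>2 + 2 * (norm (S F t - h' t))\<^sup>2" for t
      using norm_add_power2_le[of "h t - S F t" "S F t - h' t"] by (simp add: norm_minus_commute)
    then have "(LINT t|unit_leb. (norm (h t - h' t))\<^sup>2)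
        \<le> (LINT t|unit_leb. 2 * (norm (S F t - h t))\<^sup>2 + 2 * (norm (S F t - h' t))\<^sup>2)"
      by (intro integral_mono) (auto intro!: int L2 S)
    then show ?thesis unfolding L2_norm_power2 by (simp add: int L2 S)
  qed
  have "((\<lambda>F. 2 * (L2_norm (\<lambda>t. S F t - h t))\<^sup>2 + 2 * (L2_norm (\<lambda>t. S F t - h' t))\<^sup>2) \<longlongrightarrow> 2 * 0\<^sup>2 + 2 * 0\<^sup>2)
      (finite_subsets_at_top UNIV)"
    using assms unfolding has_L2_sum_def S_def by (intro tendsto_intros) auto
  then have "(LINT t|unit_leb. (norm (h t - h' t))\<^sup>2) \<le> 2 * 0\<^sup>2 + 2 * 0\<^sup>2"
    by (rule tendsto_lowerbound) (auto intro!: always_eventually le)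
  then have "(LINT t|unit_leb. (norm (h t - h' t))\<^sup>2) = 0"
    by (intro antisym) (auto intro: integral_nonneg_AE)
  then have "AE t in unit_leb. (norm (h t - h' t))\<^sup>2 = 0"
    by (subst (asm) integral_nonneg_eq_0_iff_AE) (auto intro: int L2)
  then show ?thesis by simp
qed

text \<open>
  Uniqueness of \<open>L\<^sup>2\<close> sums makes the function selected by the choice operator agree almost everywhere
  with the explicit one.
\<close>

lemma fourier_part_eq_residue_part:
  assumes f: "bounded_periodic f" and K: "0 < K"
    and g: "g \<in> borel_measurable unit_leb" and gf: "AE t in unit_leb. g t = f t"
  shows "AE t in unit_leb. fourier_part g K k t = residue_part K k f t"
proof -
  have "L2_inner g (trig m) = L2_inner f (trig m)" for m
    unfolding L2_inner_def
  proof (rule integral_cong_AE)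
    have [measurable]: "f \<in> borel_measurable unit_leb" "(\<lambda>t. cnj (trig m t)) \<in> borel_measurable unit_leb"
      by (intro borel_measurable_integrable bounded_periodic_integrable bounded_periodic_cnj
          bounded_periodic_trig f)+
    note [measurable] = g
    show "(\<lambda>t. g t * cnj (trig m t)) \<in> borel_measurable unit_leb"
      "(\<lambda>t. f t * cnj (trig m t)) \<in> borel_measurable unit_leb" by measurable
    show "AE t in unit_leb. g t * cnj (trig m t) = f t * cnj (trig m t)"
      using gf by eventually_elim simp
  qed
  then have "has_L2_sum (\<lambda>n t. L2_inner g (trig (n * int K + int k)) * trig (n * int K + int k) t)
      (residue_part K k f)"
    using has_L2_sum_residue_part[OF f K] by simp
  then show ?thesis
    unfolding fourier_part_def by (intro has_L2_sum_unique[OF someI[where P = "has_L2_sum _"]])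
qed


text \<open>
  The Borel version is extended periodically through the fractional part and set to 0 where it exceeds
  the essential bound.
\<close>

lemma bounded_periodic_representative:
  assumes "in_Linf g"
  obtains f where "bounded_periodic f" "AE t in unit_leb. g t = f t"
proof -
  obtain C where g: "g \<in> borel_measurable unit_leb" and C: "AE t in unit_leb. norm (g t) \<le> C"
    using assms by (auto simp: in_Linf_def)
  define G where "G t = (if t \<in> {0..1} then g t else 0)" for t
  have [measurable]: "G \<in> borel_measurable lebesgue"
    using g borel_measurable_if[of "{0..1}" g] unfolding G_def by simp
  obtain u where u[measurable]: "u \<in> borel_measurable borel" and u_eq: "AE t in lborel. Re (G t) = u t"
    using completion_ex_borel_measurable_real[of "\<lambda>t. Re (G t)" lborel] by auto
  obtain v where v[measurable]: "v \<in> borel_measurable borel" and v_eq: "AE t in lborel. Im (G t) = v t"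
    using completion_ex_borel_measurable_real[of "\<lambda>t. Im (G t)" lborel] by auto
  define w where "w t = Complex (u (frac t)) (v (frac t))" for t
  define f where "f t = (if norm (w t) \<le> C then w t else 0)" for t
  have [measurable]: "(frac :: real \<Rightarrow> real) \<in> borel_measurable borel"
    unfolding frac_def by measurable
  have [measurable]: "w \<in> borel_measurable borel"
    unfolding w_def Complex_eq by measurable
  have "bounded_periodic f"
  proof (rule bounded_periodicI[where C = "\<bar>C\<bar>"])
    show "f \<in> borel_measurable borel" unfolding f_def by measurable
    show "norm (f t) \<le> \<bar>C\<bar>" for t unfolding f_def by auto
    show "f (t + 1) = f t" for t unfolding f_def w_def by (simp add: frac_1_eq)
  qed
  moreover have "AE t in unit_leb. g t = f t"
    using C AE_unit_lebI[OF u_eq] AE_unit_lebI[OF v_eq] AE_unit_lebI[OF AE_lborel_singleton[of 1]] AE_space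
  proof eventually_elim
    case (elim t)
    then have "frac t = t" by (simp add: frac_eq)
    then have "w t = g t" using elim by (simp add: w_def G_def complex_eq_iff)
    then show ?case using elim by (simp add: f_def)
  qed
  ultimately show ?thesis by (rule that)
qed

section \<open>Convergence of Riemann sums in the mean\<close>

lemma L1_le_L2:
  assumes f: "bounded_periodic f" and e: "0 < e" and le: "(LINT t|unit_leb. (norm (f t))\<^sup>2) \<le> e\<^sup>2"
  shows "(LINT t|unit_leb. norm (f t)) \<le> e"
proof -
  have "norm (f t) \<le> e / 2 + (norm (f t))\<^sup>2 * (1 / (2 * e))" for t
    using sum_squares_bound[of "norm (f t)" e] e by (simp add: field_simps power2_eq_square)
  then have "(LINT t|unit_leb. norm (f t)) \<le> (LINT t|unit_leb. e / 2 + (norm (f t))\<^sup>2 * (1 / (2 * e)))"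
    by (intro integral_mono Bochner_Integration.integrable_add integrable_mult_left integrable_norm_power2 f
        integrable_norm bounded_periodic_integrable
        finite_measure.integrable_const[OF finite_measure_unit_leb])
  also have "\<dots> = e / 2 + (LINT t|unit_leb. (norm (f t))\<^sup>2) * (1 / (2 * e))"
    by (subst Bochner_Integration.integral_add)
       (use measure_unit_leb integrable_norm_power2[OF f]
         finite_measure.integrable_const[OF finite_measure_unit_leb] in auto)
  also have "\<dots> \<le> e / 2 + e\<^sup>2 * (1 / (2 * e))"
    using e le by (intro add_left_mono mult_right_mono) auto
  also have "\<dots> = e" using e by (simp add: power2_eq_square)
  finally show ?thesis .
qed

lemma residue_part_0_L1_contraction:
  assumes f: "bounded_periodic f" and K: "0 < K"
  shows "(LINT t|unit_leb. norm (residue_part K 0 f t)) \<le> (LINT t|unit_leb. norm (f t))"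
proof -
  have int: "integrable unit_leb (\<lambda>t. norm (f (t + a)))" for a
    by (intro integrable_norm bounded_periodic_integrable bounded_periodic_shift f)
  have shift: "(LINT t|unit_leb. norm (f (t + real j / real K))) = (LINT t|unit_leb. norm (f t))"
    if "j < K" for j
  proof -
    have "complex_of_real (LINT t|unit_leb. norm (f (t + real j / real K))) = complex_of_real (LINT t|unit_leb. norm (f t))"
      using integral_shift_periodic[OF bounded_periodic_norm[OF f], of "real j / real K"] that K
      by simp
    then show ?thesis by (simp only: of_real_eq_iff)
  qed
  have "norm (residue_part K 0 f t) \<le> (\<Sum>j<K. norm (f (t + real j / real K))) / real K" for t
    using norm_sum[of "\<lambda>j. f (t + real j / real K)" "{..<K}"]
    by (simp add: residue_part_def norm_divide divide_right_mono)
  then have "(LINT t|unit_leb. norm (residue_part K 0 f t))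
      \<le> (LINT t|unit_leb. (\<Sum>j<K. norm (f (t + real j / real K))) / real K)"
    by (intro integral_mono integrable_norm bounded_periodic_integrable bounded_periodic_residue_part f
        integrable_divide Bochner_Integration.integrable_sum int)
  also have "\<dots> = (\<Sum>j<K. LINT t|unit_leb. norm (f (t + real j / real K))) / real K"
    by (simp add: int)
  also have "\<dots> = (LINT t|unit_leb. norm (f t))"
    using K by (simp add: shift)
  finally show ?thesis .
qed

text \<open>
  Once \<open>K\<close> exceeds every frequency in absolute value, the only frequency divisible by \<open>K\<close> is 0.
\<close>

lemma residue_part_0_trig_polynomial:
  assumes "trig_polynomial P"
  shows "eventually (\<lambda>n. \<forall>t. residue_part (Suc n) 0 P t = (LINT t|unit_leb. P t)) sequentially"
proof -
  obtain F c where F: "finite F" and P: "P = (\<lambda>t. \<Sum>m\<in>F. c m * trig m t)"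
    using assms by (rule trig_polynomialE)
  have int: "(LINT t|unit_leb. P t) = (\<Sum>m\<in>F. c m * of_bool (m = 0))"
    unfolding P by (simp add: bounded_periodic_integrable[OF bounded_periodic_trig] integral_trig)
  have "eventually (\<lambda>n. \<forall>m\<in>F. \<bar>m\<bar> < int (Suc n)) sequentially"
  proof (intro eventually_ball_finite F ballI)
    fix m
    show "eventually (\<lambda>n. \<bar>m\<bar> < int (Suc n)) sequentially"
      using eventually_ge_at_top[of "nat \<bar>m\<bar>"] by eventually_elim linarith
  qed
  then show ?thesis
  proof eventually_elim
    case (elim n)
    have dvd: "int (Suc n) dvd m \<longleftrightarrow> m = 0" if "m \<in> F" for m
      using elim[rule_format, OF that] dvd_imp_le_int[of m "int (Suc n)"] by auto
    have "residue_part (Suc n) 0 P t = (\<Sum>m\<in>F. c m * of_bool (m = 0))" for t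
    proof -
      have "residue_part (Suc n) 0 P t
          = (\<Sum>m\<in>F. c m * trig m t * ((\<Sum>j<Suc n. trig m (real j / real (Suc n))) / of_nat (Suc n)))"
        unfolding residue_part_def P trig_add_time sum_distrib_left sum_divide_distrib
        by (subst sum.swap) (simp add: mult_ac)
      also have "\<dots> = (\<Sum>m\<in>F. c m * of_bool (m = 0))"
      proof (rule sum.cong[OF refl])
        fix m assume m: "m \<in> F"
        have "(of_nat (Suc n) :: complex) \<noteq> 0" by (rule of_nat_neq_0)
        then show "c m * trig m t * ((\<Sum>j<Suc n. trig m (real j / real (Suc n))) / of_nat (Suc n))
            = c m * of_bool (m = 0)"
          unfolding sum_trig_roots_of_unity[OF zero_less_Suc] dvd[OF m] by auto
      qed
      finally show ?thesis .
    qed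
    then show ?case by (simp add: int)
  qed
qed

lemma residue_part_diff:
  "residue_part K k (\<lambda>t. f t - g t) t = residue_part K k f t - residue_part K k g t"
  unfolding residue_part_def by (simp add: right_diff_distrib sum_subtractf diff_divide_distrib)

text \<open>
  With \<open>P\<close> close to \<open>f\<close>, the Riemann sum of \<open>f\<close> differs from that of \<open>P\<close> by a contraction applied to
  \<open>f - P\<close>, the Riemann sum of \<open>P\<close> is its mean, and the means of \<open>P\<close> and \<open>f\<close> are close.
\<close>

lemma residue_part_0_tendsto_integral:
  assumes f: "bounded_periodic f"
  shows "(\<lambda>n. LINT t|unit_leb. norm (residue_part (Suc n) 0 f t - (LINT t|unit_leb. f t))) \<longlonglongrightarrow> 0"
proof (rule tendstoI)
  fix e :: real assume e: "0 < e"
  \<comment> \<open>one third of the tolerance is spent on the Riemann sums of \<open>f - P\<close> and one on the difference of the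
    means; the last one makes the inequality strict\<close>
  obtain P where P: "trig_polynomial P" "(LINT t|unit_leb. (norm (f t - P t))\<^sup>2) < (e / 3)\<^sup>2"
    using trig_polynomial_L2_dense[OF f, of "(e / 3)\<^sup>2"] e by auto
  have bP: "bounded_periodic P" by (rule trig_polynomial_bounded_periodic[OF P(1)])
  note bfP = bounded_periodic_diff[OF f bP]
  have L1: "(LINT t|unit_leb. norm (f t - P t)) \<le> e / 3"
    using P(2) e by (intro L1_le_L2 bfP) auto
  have mean_diff: "(LINT t|unit_leb. P t) - (LINT t|unit_leb. f t) = (LINT t|unit_leb. P t - f t)"
    by (simp add: bounded_periodic_integrable f bP)
  have mean: "norm ((LINT t|unit_leb. P t) - (LINT t|unit_leb. f t)) \<le> e / 3"
    using Bochner_Integration.integral_norm_bound[of unit_leb "\<lambda>t. P t - f t"] L1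
    unfolding mean_diff norm_minus_commute[of "P _"] by linarith
  show "eventually (\<lambda>n. dist (LINT t|unit_leb. norm (residue_part (Suc n) 0 f t - (LINT t|unit_leb. f t))) 0 < e) sequentially"
    using residue_part_0_trig_polynomial[OF P(1)]
  proof eventually_elim
    case (elim n)
    let ?R = "residue_part (Suc n) 0"
    have "norm (?R f t - (LINT t|unit_leb. f t)) \<le> norm (?R (\<lambda>t. f t - P t) t) + e / 3" for t
      using norm_triangle_ineq[of "?R f t - ?R P t" "?R P t - (LINT t|unit_leb. f t)"] mean elim
      by (simp add: residue_part_diff)
    then have "(LINT t|unit_leb. norm (?R f t - (LINT t|unit_leb. f t)))
        \<le> (LINT t|unit_leb. norm (?R (\<lambda>t. f t - P t) t) + e / 3)"
      by (intro integral_mono Bochner_Integration.integrable_add integrable_norm bounded_periodic_integrable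
          bounded_periodic_diff bounded_periodic_residue_part bounded_periodic_const f bP
          finite_measure.integrable_const[OF finite_measure_unit_leb])
    also have "\<dots> = (LINT t|unit_leb. norm (?R (\<lambda>t. f t - P t) t)) + e / 3"
      by (subst Bochner_Integration.integral_add)
         (use measure_unit_leb bounded_periodic_integrable[OF bounded_periodic_residue_part[OF bfP]]
           finite_measure.integrable_const[OF finite_measure_unit_leb] in auto)
    also have "\<dots> \<le> e / 3 + e / 3"
      using residue_part_0_L1_contraction[OF bfP, of "Suc n"] L1 by simp
    also have "\<dots> < e" using e by simp
    finally show ?case by (simp add: integral_nonneg_AE)
  qed
qed

section \<open>The square function of the residue parts\<close>

theorem theorem6p24:
  fixes g :: "real \<Rightarrow> complex"
  assumes "in_Linf g"
  shows "\<exists>K :: nat \<Rightarrow> nat. strict_mono K \<and> (\<forall>n. K n \<ge> 1) \<and>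
    (AE t in unit_leb.
      (\<lambda>n. sqrt (\<Sum>k<K n. (norm (fourier_part g (K n) k t))\<^sup>2))
        \<longlonglongrightarrow> L2_norm g * indicator {0..1} t)"
proof -
  have g: "g \<in> borel_measurable unit_leb" using assms by (simp add: in_Linf_def)
  obtain f where f: "bounded_periodic f" and gf: "AE t in unit_leb. g t = f t"
    using bounded_periodic_representative[OF assms] by blast
  define F where "F t = complex_of_real ((norm (f t))\<^sup>2)" for t
  define I where "I = (LINT t|unit_leb. (norm (f t))\<^sup>2)"
  have F: "bounded_periodic F" unfolding F_def by (rule bounded_periodic_norm_power2[OF f])
  have I: "(LINT t|unit_leb. F t) = complex_of_real I"
    unfolding F_def I_def by (rule integral_complex_of_real)
  have norm_g: "L2_norm g = sqrt I"
  proof -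
    have "f \<in> borel_measurable unit_leb"
      by (rule borel_measurable_integrable[OF bounded_periodic_integrable[OF f]])
    note [measurable] = g this
    have "(LINT t|unit_leb. (norm (g t))\<^sup>2) = I"
      unfolding I_def
    proof (rule integral_cong_AE)
      show "AE t in unit_leb. (norm (g t))\<^sup>2 = (norm (f t))\<^sup>2"
        using gf by eventually_elim simp
    qed measurable
    then show ?thesis by (simp add: L2_norm_def)
  qed
  obtain r where r: "strict_mono r"
      and lim: "AE t in unit_leb. (\<lambda>n. residue_part (Suc (r n)) 0 F t - complex_of_real I) \<longlonglongrightarrow> 0"
    using tendsto_L1_AE_subseq[of unit_leb "\<lambda>n t. residue_part (Suc n) 0 F t - complex_of_real I"]
      residue_part_0_tendsto_integral[OF F]
      bounded_periodic_integrable[OF bounded_periodic_diff[OF bounded_periodic_residue_part[OF F] bounded_periodic_const]]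
    unfolding I by blast
  have "AE t in unit_leb. \<forall>n k. fourier_part g (Suc n) k t = residue_part (Suc n) k f t"
    unfolding AE_all_countable by (intro allI fourier_part_eq_residue_part[OF f _ g gf]) simp
  then have "AE t in unit_leb. (\<lambda>n. sqrt (\<Sum>k<Suc (r n). (norm (fourier_part g (Suc (r n)) k t))\<^sup>2))
      \<longlonglongrightarrow> L2_norm g * indicator {0..1} t"
    using lim AE_space
  proof eventually_elim
    case (elim t)
    have "residue_part (Suc (r n)) 0 F t
        = complex_of_real (\<Sum>k<Suc (r n). (norm (fourier_part g (Suc (r n)) k t))\<^sup>2)" for n
      using sum_norm_residue_part[of "Suc (r n)" f t] elim(1) unfolding F_def by simp
    with elim(2) have "(\<lambda>n. complex_of_real (\<Sum>k<Suc (r n). (norm (fourier_part g (Suc (r n)) k t))\<^sup>2))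
        \<longlonglongrightarrow> complex_of_real I"
      by (simp only: LIM_zero_iff)
    then have "(\<lambda>n. sqrt (\<Sum>k<Suc (r n). (norm (fourier_part g (Suc (r n)) k t))\<^sup>2)) \<longlonglongrightarrow> sqrt I"
      by (intro tendsto_real_sqrt) (simp only: tendsto_of_real_iff)
    then show ?case using elim(3) by (simp add: norm_g)
  qed
  moreover have "strict_mono (\<lambda>n. Suc (r n))" using r by (simp add: strict_mono_def)
  ultimately show ?thesis by (intro exI[of _ "\<lambda>n. Suc (r n)"]) auto
qed

end
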